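(* Let $n\ge 2$ be an integer with square-free part $n_0$. Then $$\tilde Q_n=\frac{n}{n_0}\,\tilde Q_{n_0}.$$
   Context: Let $p_1<\dots<p_r$ be the distinct primes dividing $n$ and let $n_0=p_1p_2\cdots p_r$ (called the square-free part of $n$). The divisors of $n_0$ are ordered as $(d_1,\dots,d_{2^r})$ recursively: for $r=1$ the order is $(1,p_1)$, and for $r$ primes the first $2^{r-1}$ entries are those for the primes $p_1,\dots,p_{r-1}$, the remaining $2^{r-1}$ entries being obtained by multiplying each of these, in order, by $p_r$. In particular $d_1=1$ and $d_{2^r}=n_0$. For a divisor $d$ of $n_0$, $[d]=\{a\in\{0,1,\dots,n-1\}:\gcd(a,n_0)=d\}$ (with $\gcd(0,n_0)=n_0$), and $a_i=|[d_{i+1}]|$ for $1\le i\le 2^r-1$. $\tilde Q_n$ is the symmetric real $2^r\times 2^r$ matrix whose $(1,1)$ entry is $\varphi(n)$, whose other diagonal entries are $0$, and whose off-diagonal entries are $\rho_{i,j}$, where $\rho_{1,j}=\rho_{j,1}=\sqrt{\varphi(n)a_{j-1}}$ for $j\ge2$, and for $i\neq j$ with $i,j\ge 2$, $\rho_{i,j}=\sqrt{a_{i-1}a_{j-1}}$ if $\gcd(d_i,d_j)=1$ and $\rho_{i,j}=0$ otherwise. $\tilde Q_{n_0}$ is the same matrix constructed for $n_0$ in place of $n$ (same primes, same ordering of divisors). $\varphi$ is Euler's totient function. *)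

theory Defs
  imports
    "Jordan_Normal_Form.Matrix"
    "HOL-Number_Theory.Totient"
    Complex_Main
begin

(* The product of the distinct primes dividing n; this differs from the library's squarefree_part,
   which takes only the primes of odd multiplicity. *)
definition sqf :: "nat \<Rightarrow> nat" where
  "sqf n = \<Prod>(prime_factors n)"

(* The empty list of primes gives [1], so a single prime p gives [1, p]. *)
definition ordered_divisors :: "nat list \<Rightarrow> nat list" where
  "ordered_divisors ps = foldl (\<lambda>ds p. ds @ map (\<lambda>d. d * p) ds) [1] ps"

(* Entry i (counted from 0) is the divisor d_{i+1} of sqf n. *)
definition sqf_divisors :: "nat \<Rightarrow> nat list" where
  "sqf_divisors n = ordered_divisors (sorted_list_of_set (prime_factors n))"

definition gcd_class :: "nat \<Rightarrow> nat \<Rightarrow> nat set" where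
  "gcd_class n d = {a \<in> {0..<n}. gcd a (sqf n) = d}"

(* As sqf_divisors counts from 0, class_size n i is a_i = |[d_{i+1}]| with the index unshifted. *)
definition class_size :: "nat \<Rightarrow> nat \<Rightarrow> nat" where
  "class_size n i = card (gcd_class n (sqf_divisors n ! i))"

(* Rows and columns count from 0: entry (i, j) here is entry (i+1, j+1) in the usual numbering. *)
definition Q_tilde :: "nat \<Rightarrow> real mat" where
  "Q_tilde n = mat (2 ^ card (prime_factors n)) (2 ^ card (prime_factors n)) (\<lambda>(i, j).
     if i = 0 \<and> j = 0 then real (totient n)
     else if i = j then 0
     else if i = 0 then sqrt (real (totient n) * real (class_size n j))
     else if j = 0 then sqrt (real (totient n) * real (class_size n i))
     else if gcd (sqf_divisors n ! i) (sqf_divisors n ! j) = 1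
       then sqrt (real (class_size n i) * real (class_size n j))
     else 0)"

lemma ordered_divisors_Nil [simp]: "ordered_divisors [] = [1]"
  by (simp add: ordered_divisors_def)

lemma ordered_divisors_snoc [simp]:
  "ordered_divisors (ps @ [p]) = ordered_divisors ps @ map (\<lambda>d. d * p) (ordered_divisors ps)"
  by (simp add: ordered_divisors_def)

lemma length_ordered_divisors: "length (ordered_divisors ps) = 2 ^ length ps"
  by (induction ps rule: rev_induct) simp_all

lemma length_sqf_divisors: "length (sqf_divisors n) = 2 ^ card (prime_factors n)"
  by (simp add: sqf_divisors_def length_ordered_divisors)

lemma prime_factors_sqf: "prime_factors (sqf n) = prime_factors n"
proof -
  have "prime_factors (sqf n) = \<Union>(prime_factors ` prime_factors n)"
    unfolding sqf_def by (subst prime_factors_prod) auto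
  also have "\<dots> = prime_factors n"
    by (auto simp: prime_prime_factors in_prime_factors_imp_prime)
  finally show ?thesis .
qed

lemma sqf_divisors_sqf: "sqf_divisors (sqf n) = sqf_divisors n"
  by (simp add: sqf_divisors_def prime_factors_sqf)

lemma sqf_sqf: "sqf (sqf n) = sqf n"
  by (simp add: sqf_def[of "sqf n"] prime_factors_sqf) (simp add: sqf_def)

end

theory Submission
  imports Defs
begin

text \<open>
  Write \<open>m = sqf n\<close> and \<open>n = k * m\<close>. Since \<open>gcd a m\<close> depends only on \<open>a mod m\<close>, every gcd class
  modulo \<open>n\<close> consists of \<open>k\<close> copies of the corresponding class modulo \<open>m\<close>; likewise
  \<open>\<phi>(n) = k \<phi>(m)\<close> by Euler's product formula. Every entry is homogeneous of degree one in these
  cardinalities, so the whole matrix is scaled by \<open>k\<close>.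
\<close>

lemma card_gcd_eq_mult:
  fixes k m d :: nat
  shows "card {a \<in> {0..<k * m}. gcd a m = d} = k * card {a \<in> {0..<m}. gcd a m = d}"
proof (cases "m = 0")
  case False
  \<comment> \<open>Here \<open>q\<close> numbers the copy of the class modulo \<open>m\<close> and
    \<open>r\<close> is the residue; division with remainder inverts the map.\<close>
  have "bij_betw (\<lambda>(q, r). q * m + r) ({0..<k} \<times> {a \<in> {0..<m}. gcd a m = d})
          {a \<in> {0..<k * m}. gcd a m = d}"
  proof (rule bij_betw_byWitness[where f' = "\<lambda>a. (a div m, a mod m)"])
    have "q * m + r < k * m" if "q < k" "r < m" for q r
    proof -
      have "q * m + r < Suc q * m" using that by simp
      also have "\<dots> \<le> k * m" using that by (intro mult_le_mono1) simp
      finally show ?thesis .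
    qed
    then show "(\<lambda>(q, r). q * m + r) ` ({0..<k} \<times> {a \<in> {0..<m}. gcd a m = d})
        \<subseteq> {a \<in> {0..<k * m}. gcd a m = d}"
      by (auto simp: gcd.commute[of _ m] gcd_add_mult)
    show "(\<lambda>a. (a div m, a mod m)) ` {a \<in> {0..<k * m}. gcd a m = d}
        \<subseteq> {0..<k} \<times> {a \<in> {0..<m}. gcd a m = d}"
      using False by (auto simp: less_mult_imp_div_less gcd.commute[of _ m] gcd_red_nat[of _ m, symmetric])
  qed (use False in auto)
  from bij_betw_same_card[OF this] show ?thesis
    by (simp add: card_cartesian_product)
qed simp

lemma sqf_dvd: "sqf n dvd n"
proof (cases "n = 0")
  case False
  \<comment> \<open>Factor by factor: a prime factor has multiplicity at least one, so it divides
    its power.\<close>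
  have "sqf n dvd (\<Prod>p\<in>prime_factors n. p ^ multiplicity p n)"
    unfolding sqf_def
    by (intro prod_dvd_prod) (auto simp: prime_factors_multiplicity intro: dvd_power)
  also have "\<dots> = n"
    using False by (simp add: prod_prime_factors)
  finally show ?thesis .
qed simp

text \<open>By Euler's formula both sides equal \<open>n * sqf n\<close> times the product of
  \<open>1 - 1/p\<close> over the same primes.\<close>

lemma totient_sqf: "totient (sqf n) * n = totient n * sqf n"
proof -
  have "real (totient (sqf n) * n) = real (totient n * sqf n)"
    by (simp add: totient_formula2 prime_factors_sqf)
  then show ?thesis by (simp only: of_nat_eq_iff)
qed

lemma sqf_pos: "sqf n > 0"
  by (auto simp: sqf_def intro!: prod_pos prime_gt_0_nat)

theorem proposition4p2p3:
  fixes n :: nat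
  assumes "n \<ge> 2"
  shows "Q_tilde n = (real n / real (sqf n)) \<cdot>\<^sub>m Q_tilde (sqf n)"
proof -
  obtain k where n: "n = k * sqf n"
    using sqf_dvd[of n] by (auto elim!: dvdE simp: mult.commute)
  have k: "real n / real (sqf n) = real k"
    using sqf_pos[of n] by (subst n) simp
  have class_size: "class_size n i = k * class_size (sqf n) i" for i
    using card_gcd_eq_mult[of k "sqf n" "sqf_divisors n ! i"]
    by (simp add: class_size_def gcd_class_def sqf_divisors_sqf sqf_sqf flip: n)
  have "totient n * sqf n = (k * totient (sqf n)) * sqf n"
    using totient_sqf[of n] n by (metis mult.assoc mult.commute)
  then have totient: "totient n = k * totient (sqf n)"
    using sqf_pos[of n] by simp
  have sqrt_scale: "sqrt (real (k * a) * real (k * b)) = real k * sqrt (real a * real b)" for a b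
    by (simp add: real_sqrt_mult)
  show ?thesis
    unfolding k
    \<comment> \<open>Deleting \<open>of_nat_mult\<close> keeps products inside \<open>real\<close>,
      the form that \<open>sqrt_scale\<close> matches; the final \<open>simp_all\<close> has it back
      for the corner entry \<open>totient n\<close>.\<close>
    by (rule eq_matI)
       (simp_all add: Q_tilde_def prime_factors_sqf sqf_divisors_sqf totient class_size sqrt_scale
         del: of_nat_mult, simp_all)
qed

end
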